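(* Let $\Gamma=(F,G,\eta,\rho)$ be a right wide Morita context between the abelian categories $\mathcal A$ and $\mathcal B$. Then the following assertions are equivalent. (1) $\Gamma$ is invertible. (2) $\Gamma$ is a strict right wide Morita context, i.e. $F$ and $G$ define an equivalence between the categories $\mathcal A$ and $\mathcal B$ with natural equivalences $\eta:F\circ G\to 1_{\mathcal A}$ and $\rho:G\circ F\to 1_{\mathcal B}$.
   Context: All functors are additive. A right wide Morita context between abelian categories $\mathcal A$ and $\mathcal B$ is a datum $(F,G,\eta,\rho)$ where $F:\mathcal B\to\mathcal A$ and $G:\mathcal A\to\mathcal B$ are right exact functors and $\eta:F\circ G\to 1_{\mathcal A}$, $\rho:G\circ F\to 1_{\mathcal B}$ are natural transformations with $G\eta=\rho G$ and $F\rho=\eta F$. It is strict if $\eta(X)$ and $\rho(Y)$ are epimorphisms for all $X\in\mathcal A$, $Y\in\mathcal B$ (in which case $\eta$ and $\rho$ are in fact natural equivalences). Composition: if $\Gamma=(F,G,\eta,\rho)$ is a right wide Morita context between $\mathcal A$ and $\mathcal B$ and $\Delta=(U,V,\epsilon,\delta)$ one between $\mathcal B$ and $\mathcal C$, then $\Gamma\circ\Delta=(F\circ U,V\circ G,\gamma,\pi)$, where $\gamma(X)=\eta(X)\circ F(\epsilon(G(X)))$ for $X\in\mathcal A$ and $\pi(Z)=\delta(Z)\circ V(\rho(U(Z)))$ for $Z\in\mathcal C$; this is a right wide Morita context between $\mathcal A$ and $\mathcal C$. Identity: $\mathbf 1_{\mathcal A}=(1_{\mathcal A},1_{\mathcal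 A},\mathrm{Id}_{1_{\mathcal A}},\mathrm{Id}_{1_{\mathcal A}})$. Isomorphism: two right wide Morita contexts $(F,G,\eta,\rho)$ and $(P,Q,\alpha,\beta)$ between $\mathcal A$ and $\mathcal B$ are isomorphic ($\simeq$) if there are natural equivalences $u:F\to P$, $v:G\to Q$ such that $\alpha(X)\circ P(v(X))\circ u(G(X))=\eta(X)$ for all $X\in\mathcal A$ and $\beta(Y)\circ Q(u(Y))\circ v(F(Y))=\rho(Y)$ for all $Y\in\mathcal B$. Invertible: $\Gamma$ (between $\mathcal A$ and $\mathcal B$) is invertible if there is a right wide Morita context $\Delta$ between $\mathcal B$ and $\mathcal A$ with $\Gamma\circ\Delta\simeq\mathbf 1_{\mathcal A}$ and $\Delta\circ\Gamma\simeq\mathbf 1_{\mathcal B}$. *)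

theory Defs
  imports "HOL-Algebra.Group"
begin

text \<open>
  Categories are partial structures on an object type \<open>'o\<close> and an arrow type \<open>'m\<close>. Only the objects in
  \<open>Ob C\<close> and the arrows in \<open>Arr C\<close> matter; every arrow determines its domain and codomain.
\<close>

record ('o, 'm) cat =
  Ob :: "'o set"
  Arr :: "'m set"
  Dom :: "'m \<Rightarrow> 'o"
  Cod :: "'m \<Rightarrow> 'o"
  Idt :: "'o \<Rightarrow> 'm"
  Comp :: "'m \<Rightarrow> 'm \<Rightarrow> 'm"  (infixr "\<cdot>\<index>" 70)

record ('o, 'm) ab_cat = "('o, 'm) cat" +
  Add :: "'m \<Rightarrow> 'm \<Rightarrow> 'm"
  Zero :: "'o \<Rightarrow> 'o \<Rightarrow> 'm"

definition Hom :: "('o, 'm, 'z) cat_scheme \<Rightarrow> 'o \<Rightarrow> 'o \<Rightarrow> 'm set" where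
  "Hom C X Y = {f \<in> Arr C. Dom C f = X \<and> Cod C f = Y}"

locale category =
  fixes C :: "('o, 'm, 'z) cat_scheme" (structure)
  assumes Dom_closed: "f \<in> Arr C \<Longrightarrow> Dom C f \<in> Ob C"
    and Cod_closed: "f \<in> Arr C \<Longrightarrow> Cod C f \<in> Ob C"
    and Idt_closed: "X \<in> Ob C \<Longrightarrow> Idt C X \<in> Hom C X X"
    and Comp_closed: "f \<in> Hom C X Y \<Longrightarrow> g \<in> Hom C Y Z \<Longrightarrow> g \<cdot> f \<in> Hom C X Z"
    and Idt_left: "f \<in> Hom C X Y \<Longrightarrow> Idt C Y \<cdot> f = f"
    and Idt_right: "f \<in> Hom C X Y \<Longrightarrow> f \<cdot> Idt C X = f"
    and Comp_assoc: "f \<in> Hom C W X \<Longrightarrow> g \<in> Hom C X Y \<Longrightarrow> h \<in> Hom C Y Z \<Longrightarrow>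
      (h \<cdot> g) \<cdot> f = h \<cdot> (g \<cdot> f)"

definition is_mono :: "('o, 'm, 'z) cat_scheme \<Rightarrow> 'm \<Rightarrow> bool" where
  "is_mono C f \<longleftrightarrow> f \<in> Arr C \<and>
    (\<forall>W. \<forall>g \<in> Hom C W (Dom C f). \<forall>h \<in> Hom C W (Dom C f). f \<cdot>\<^bsub>C\<^esub> g = f \<cdot>\<^bsub>C\<^esub> h \<longrightarrow> g = h)"

definition is_epi :: "('o, 'm, 'z) cat_scheme \<Rightarrow> 'm \<Rightarrow> bool" where
  "is_epi C f \<longleftrightarrow> f \<in> Arr C \<and>
    (\<forall>Z. \<forall>g \<in> Hom C (Cod C f) Z. \<forall>h \<in> Hom C (Cod C f) Z. g \<cdot>\<^bsub>C\<^esub> f = h \<cdot>\<^bsub>C\<^esub> f \<longrightarrow> g = h)"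

definition is_iso :: "('o, 'm, 'z) cat_scheme \<Rightarrow> 'm \<Rightarrow> bool" where
  "is_iso C f \<longleftrightarrow> f \<in> Arr C \<and>
    (\<exists>g \<in> Hom C (Cod C f) (Dom C f).
      g \<cdot>\<^bsub>C\<^esub> f = Idt C (Dom C f) \<and> f \<cdot>\<^bsub>C\<^esub> g = Idt C (Cod C f))"


subsection \<open>Abelian categories\<close>

definition hom_group :: "('o, 'm, 'z) ab_cat_scheme \<Rightarrow> 'o \<Rightarrow> 'o \<Rightarrow> 'm monoid" where
  "hom_group C X Y = \<lparr>carrier = Hom C X Y, monoid.mult = Add C, one = Zero C X Y\<rparr>"

locale preadditive_category = category C
  for C :: "('o, 'm, 'z) ab_cat_scheme" (structure) +
  assumes hom_comm_group: "X \<in> Ob C \<Longrightarrow> Y \<in> Ob C \<Longrightarrow> comm_group (hom_group C X Y)"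
    and Comp_Add_left: "f \<in> Hom C X Y \<Longrightarrow> g \<in> Hom C Y Z \<Longrightarrow> h \<in> Hom C Y Z \<Longrightarrow>
      Add C g h \<cdot> f = Add C (g \<cdot> f) (h \<cdot> f)"
    and Comp_Add_right: "g \<in> Hom C X Y \<Longrightarrow> h \<in> Hom C X Y \<Longrightarrow> f \<in> Hom C Y Z \<Longrightarrow>
      f \<cdot> Add C g h = Add C (f \<cdot> g) (f \<cdot> h)"

definition is_zero_object :: "('o, 'm, 'z) cat_scheme \<Rightarrow> 'o \<Rightarrow> bool" where
  "is_zero_object C Z \<longleftrightarrow> Z \<in> Ob C \<and>
    (\<forall>X \<in> Ob C. (\<exists>!f. f \<in> Hom C X Z) \<and> (\<exists>!f. f \<in> Hom C Z X))"

definition is_biproduct ::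
  "('o, 'm, 'z) ab_cat_scheme \<Rightarrow> 'o \<Rightarrow> 'o \<Rightarrow> 'o \<Rightarrow> 'm \<Rightarrow> 'm \<Rightarrow> 'm \<Rightarrow> 'm \<Rightarrow> bool" where
  "is_biproduct C X Y P i j p q \<longleftrightarrow>
    P \<in> Ob C \<and> i \<in> Hom C X P \<and> j \<in> Hom C Y P \<and> p \<in> Hom C P X \<and> q \<in> Hom C P Y \<and>
    p \<cdot>\<^bsub>C\<^esub> i = Idt C X \<and> q \<cdot>\<^bsub>C\<^esub> j = Idt C Y \<and>
    p \<cdot>\<^bsub>C\<^esub> j = Zero C Y X \<and> q \<cdot>\<^bsub>C\<^esub> i = Zero C X Y \<and>
    Add C (i \<cdot>\<^bsub>C\<^esub> p) (j \<cdot>\<^bsub>C\<^esub> q) = Idt C P"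

definition is_kernel :: "('o, 'm, 'z) ab_cat_scheme \<Rightarrow> 'm \<Rightarrow> 'm \<Rightarrow> bool" where
  "is_kernel C f k \<longleftrightarrow> f \<in> Arr C \<and> k \<in> Arr C \<and> Cod C k = Dom C f \<and>
    f \<cdot>\<^bsub>C\<^esub> k = Zero C (Dom C k) (Cod C f) \<and>
    (\<forall>W. \<forall>h \<in> Hom C W (Dom C f). f \<cdot>\<^bsub>C\<^esub> h = Zero C W (Cod C f) \<longrightarrow>
      (\<exists>!u. u \<in> Hom C W (Dom C k) \<and> k \<cdot>\<^bsub>C\<^esub> u = h))"

definition is_cokernel :: "('o, 'm, 'z) ab_cat_scheme \<Rightarrow> 'm \<Rightarrow> 'm \<Rightarrow> bool" where
  "is_cokernel C f c \<longleftrightarrow> f \<in> Arr C \<and> c \<in> Arr C \<and> Dom C c = Cod C f \<and>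
    c \<cdot>\<^bsub>C\<^esub> f = Zero C (Dom C f) (Cod C c) \<and>
    (\<forall>Z. \<forall>h \<in> Hom C (Cod C f) Z. h \<cdot>\<^bsub>C\<^esub> f = Zero C (Dom C f) Z \<longrightarrow>
      (\<exists>!u. u \<in> Hom C (Cod C c) Z \<and> u \<cdot>\<^bsub>C\<^esub> c = h))"

locale abelian_category = preadditive_category C
  for C :: "('o, 'm, 'z) ab_cat_scheme" (structure) +
  assumes ex_zero_object: "\<exists>Z. is_zero_object C Z"
    and ex_biproduct: "X \<in> Ob C \<Longrightarrow> Y \<in> Ob C \<Longrightarrow> \<exists>P i j p q. is_biproduct C X Y P i j p q"
    and ex_kernel: "f \<in> Arr C \<Longrightarrow> \<exists>k. is_kernel C f k"
    and ex_cokernel: "f \<in> Arr C \<Longrightarrow> \<exists>c. is_cokernel C f c"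
    and mono_normal: "is_mono C k \<Longrightarrow> \<exists>f. is_kernel C f k"
    and epi_normal: "is_epi C c \<Longrightarrow> \<exists>f. is_cokernel C f c"


subsection \<open>Functors and natural transformations\<close>

record ('o, 'm, 'p, 'n) fctr =
  fob :: "'o \<Rightarrow> 'p"
  far :: "'m \<Rightarrow> 'n"

definition fctr_id :: "('o, 'm, 'o, 'm) fctr" where
  "fctr_id = \<lparr>fob = (\<lambda>X. X), far = (\<lambda>f. f)\<rparr>"

definition fctr_comp ::
  "('p, 'n, 'q, 'k) fctr \<Rightarrow> ('o, 'm, 'p, 'n) fctr \<Rightarrow> ('o, 'm, 'q, 'k) fctr" (infixl "\<circ>\<^sub>F" 55) where
  "G \<circ>\<^sub>F F = \<lparr>fob = fob G \<circ> fob F, far = far G \<circ> far F\<rparr>"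

definition is_fctr ::
  "('o, 'm, 'y) cat_scheme \<Rightarrow> ('p, 'n, 'z) cat_scheme \<Rightarrow> ('o, 'm, 'p, 'n) fctr \<Rightarrow> bool" where
  "is_fctr C D F \<longleftrightarrow> category C \<and> category D \<and>
    (\<forall>X \<in> Ob C. fob F X \<in> Ob D \<and> far F (Idt C X) = Idt D (fob F X)) \<and>
    (\<forall>X Y. \<forall>f \<in> Hom C X Y. far F f \<in> Hom D (fob F X) (fob F Y)) \<and>
    (\<forall>X Y Z. \<forall>f \<in> Hom C X Y. \<forall>g \<in> Hom C Y Z. far F (g \<cdot>\<^bsub>C\<^esub> f) = far F g \<cdot>\<^bsub>D\<^esub> far F f)"

definition is_additive_fctr ::
  "('o, 'm, 'y) ab_cat_scheme \<Rightarrow> ('p, 'n, 'z) ab_cat_scheme \<Rightarrow> ('o, 'm, 'p, 'n) fctr \<Rightarrow> bool" where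
  "is_additive_fctr C D F \<longleftrightarrow> is_fctr C D F \<and>
    (\<forall>X \<in> Ob C. \<forall>Y \<in> Ob C. far F \<in> hom (hom_group C X Y) (hom_group D (fob F X) (fob F Y)))"

text \<open>
  \<open>i\<close> is an image of \<open>f\<close>, i.e. a kernel of a cokernel of \<open>f\<close>. Exactness of \<open>X \<rightarrow> Y \<rightarrow> Z\<close> at \<open>Y\<close> says that
  the image of \<open>f\<close> and the kernel of \<open>g\<close> are the same subobject of \<open>Y\<close>.
\<close>

definition is_image :: "('o, 'm, 'z) ab_cat_scheme \<Rightarrow> 'm \<Rightarrow> 'm \<Rightarrow> bool" where
  "is_image C f i \<longleftrightarrow> (\<exists>c. is_cokernel C f c \<and> is_kernel C c i)"

definition exact_at :: "('o, 'm, 'z) ab_cat_scheme \<Rightarrow> 'm \<Rightarrow> 'm \<Rightarrow> bool" where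
  "exact_at C f g \<longleftrightarrow> (\<exists>i. is_image C f i \<and> is_kernel C g i)"

text \<open>Exactness of \<open>X \<rightarrow> Y \<rightarrow> Z \<rightarrow> 0\<close>; exactness at \<open>Z\<close> means that \<open>g\<close> is an epimorphism.\<close>

definition right_exact_seq :: "('o, 'm, 'z) ab_cat_scheme \<Rightarrow> 'm \<Rightarrow> 'm \<Rightarrow> bool" where
  "right_exact_seq C f g \<longleftrightarrow> exact_at C f g \<and> is_epi C g"

definition is_right_exact_fctr ::
  "('o, 'm, 'y) ab_cat_scheme \<Rightarrow> ('p, 'n, 'z) ab_cat_scheme \<Rightarrow> ('o, 'm, 'p, 'n) fctr \<Rightarrow> bool" where
  "is_right_exact_fctr C D F \<longleftrightarrow> is_additive_fctr C D F \<and>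
    (\<forall>f g. right_exact_seq C f g \<longrightarrow> right_exact_seq D (far F f) (far F g))"

definition is_nat_trans ::
  "('o, 'm, 'y) cat_scheme \<Rightarrow> ('p, 'n, 'z) cat_scheme \<Rightarrow>
   ('o, 'm, 'p, 'n) fctr \<Rightarrow> ('o, 'm, 'p, 'n) fctr \<Rightarrow> ('o \<Rightarrow> 'n) \<Rightarrow> bool" where
  "is_nat_trans C D F G t \<longleftrightarrow> is_fctr C D F \<and> is_fctr C D G \<and>
    (\<forall>X \<in> Ob C. t X \<in> Hom D (fob F X) (fob G X)) \<and>
    (\<forall>X Y. \<forall>f \<in> Hom C X Y. t Y \<cdot>\<^bsub>D\<^esub> far F f = far G f \<cdot>\<^bsub>D\<^esub> t X)"

definition is_nat_equiv ::
  "('o, 'm, 'y) cat_scheme \<Rightarrow> ('p, 'n, 'z) cat_scheme \<Rightarrow>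
   ('o, 'm, 'p, 'n) fctr \<Rightarrow> ('o, 'm, 'p, 'n) fctr \<Rightarrow> ('o \<Rightarrow> 'n) \<Rightarrow> bool" where
  "is_nat_equiv C D F G t \<longleftrightarrow> is_nat_trans C D F G t \<and> (\<forall>X \<in> Ob C. is_iso D (t X))"


subsection \<open>Right wide Morita contexts\<close>

record ('a, 'm, 'b, 'n) context_data =
  ctxF :: "('b, 'n, 'a, 'm) fctr"
  ctxG :: "('a, 'm, 'b, 'n) fctr"
  ctx_eta :: "'a \<Rightarrow> 'm"
  ctx_rho :: "'b \<Rightarrow> 'n"

definition right_wide_Morita_context ::
  "('a, 'm, 'y) ab_cat_scheme \<Rightarrow> ('b, 'n, 'z) ab_cat_scheme \<Rightarrow> ('a, 'm, 'b, 'n) context_data \<Rightarrow> bool"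
  where
  "right_wide_Morita_context A B \<Gamma> \<longleftrightarrow> abelian_category A \<and> abelian_category B \<and>
    is_right_exact_fctr B A (ctxF \<Gamma>) \<and> is_right_exact_fctr A B (ctxG \<Gamma>) \<and>
    is_nat_trans A A (ctxF \<Gamma> \<circ>\<^sub>F ctxG \<Gamma>) fctr_id (ctx_eta \<Gamma>) \<and>
    is_nat_trans B B (ctxG \<Gamma> \<circ>\<^sub>F ctxF \<Gamma>) fctr_id (ctx_rho \<Gamma>) \<and>
    (\<forall>X \<in> Ob A. far (ctxG \<Gamma>) (ctx_eta \<Gamma> X) = ctx_rho \<Gamma> (fob (ctxG \<Gamma>) X)) \<and>
    (\<forall>Y \<in> Ob B. far (ctxF \<Gamma>) (ctx_rho \<Gamma> Y) = ctx_eta \<Gamma> (fob (ctxF \<Gamma>) Y))"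

definition strict_right_wide_Morita_context ::
  "('a, 'm, 'y) ab_cat_scheme \<Rightarrow> ('b, 'n, 'z) ab_cat_scheme \<Rightarrow> ('a, 'm, 'b, 'n) context_data \<Rightarrow> bool"
  where
  "strict_right_wide_Morita_context A B \<Gamma> \<longleftrightarrow> right_wide_Morita_context A B \<Gamma> \<and>
    (\<forall>X \<in> Ob A. is_epi A (ctx_eta \<Gamma> X)) \<and> (\<forall>Y \<in> Ob B. is_epi B (ctx_rho \<Gamma> Y))"

text \<open>
  \<open>F : B \<rightarrow> A\<close> and \<open>G : A \<rightarrow> B\<close> form an equivalence of categories, witnessed by the natural equivalences
  \<open>\<eta> : F G \<rightarrow> 1\<close> and \<open>\<rho> : G F \<rightarrow> 1\<close>.
\<close>

definition is_equivalence_of_categories ::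
  "('a, 'm, 'y) cat_scheme \<Rightarrow> ('b, 'n, 'z) cat_scheme \<Rightarrow> ('b, 'n, 'a, 'm) fctr \<Rightarrow>
   ('a, 'm, 'b, 'n) fctr \<Rightarrow> ('a \<Rightarrow> 'm) \<Rightarrow> ('b \<Rightarrow> 'n) \<Rightarrow> bool" where
  "is_equivalence_of_categories A B F G \<eta> \<rho> \<longleftrightarrow> is_fctr B A F \<and> is_fctr A B G \<and>
    is_nat_equiv A A (F \<circ>\<^sub>F G) fctr_id \<eta> \<and> is_nat_equiv B B (G \<circ>\<^sub>F F) fctr_id \<rho>"

definition context_comp ::
  "('a, 'm, 'y) cat_scheme \<Rightarrow> ('c, 'k, 'z) cat_scheme \<Rightarrow> ('a, 'm, 'b, 'n) context_data \<Rightarrow>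
   ('b, 'n, 'c, 'k) context_data \<Rightarrow> ('a, 'm, 'c, 'k) context_data" where
  "context_comp A C \<Gamma> \<Delta> =
    \<lparr>ctxF = ctxF \<Gamma> \<circ>\<^sub>F ctxF \<Delta>,
     ctxG = ctxG \<Delta> \<circ>\<^sub>F ctxG \<Gamma>,
     ctx_eta = (\<lambda>X. ctx_eta \<Gamma> X \<cdot>\<^bsub>A\<^esub> far (ctxF \<Gamma>) (ctx_eta \<Delta> (fob (ctxG \<Gamma>) X))),
     ctx_rho = (\<lambda>Z. ctx_rho \<Delta> Z \<cdot>\<^bsub>C\<^esub> far (ctxG \<Delta>) (ctx_rho \<Gamma> (fob (ctxF \<Delta>) Z)))\<rparr>"

definition context_id :: "('a, 'm, 'z) cat_scheme \<Rightarrow> ('a, 'm, 'a, 'm) context_data" where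
  "context_id A = \<lparr>ctxF = fctr_id, ctxG = fctr_id, ctx_eta = Idt A, ctx_rho = Idt A\<rparr>"

definition context_isomorphic ::
  "('a, 'm, 'y) cat_scheme \<Rightarrow> ('b, 'n, 'z) cat_scheme \<Rightarrow>
   ('a, 'm, 'b, 'n) context_data \<Rightarrow> ('a, 'm, 'b, 'n) context_data \<Rightarrow> bool" where
  "context_isomorphic A B \<Gamma> \<Gamma>' \<longleftrightarrow>
    (\<exists>u v. is_nat_equiv B A (ctxF \<Gamma>) (ctxF \<Gamma>') u \<and> is_nat_equiv A B (ctxG \<Gamma>) (ctxG \<Gamma>') v \<and>
      (\<forall>X \<in> Ob A. ctx_eta \<Gamma>' X \<cdot>\<^bsub>A\<^esub> far (ctxF \<Gamma>') (v X) \<cdot>\<^bsub>A\<^esub> u (fob (ctxG \<Gamma>) X) = ctx_eta \<Gamma> X) \<and>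
      (\<forall>Y \<in> Ob B. ctx_rho \<Gamma>' Y \<cdot>\<^bsub>B\<^esub> far (ctxG \<Gamma>') (u Y) \<cdot>\<^bsub>B\<^esub> v (fob (ctxF \<Gamma>) Y) = ctx_rho \<Gamma> Y))"

definition invertible_context ::
  "('a, 'm, 'y) ab_cat_scheme \<Rightarrow> ('b, 'n, 'z) ab_cat_scheme \<Rightarrow> ('a, 'm, 'b, 'n) context_data \<Rightarrow> bool"
  where
  "invertible_context A B \<Gamma> \<longleftrightarrow> right_wide_Morita_context A B \<Gamma> \<and>
    (\<exists>\<Delta> :: ('b, 'n, 'a, 'm) context_data. right_wide_Morita_context B A \<Delta> \<and>
      context_isomorphic A A (context_comp A A \<Gamma> \<Delta>) (context_id A) \<and>
      context_isomorphic B B (context_comp B B \<Delta> \<Gamma>) (context_id B))"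

end

theory Submission
  imports Defs
begin

text \<open>
  The compatibility \<open>G \<eta> = \<rho> G\<close>, \<open>F \<rho> = \<eta> F\<close> yields \<open>F G \<eta> = \<eta> F G\<close>. If \<open>\<eta>\<close> is epic and
  \<open>\<eta> X \<cdot> g = \<eta> X \<cdot> h\<close> with \<open>g, h : W \<rightarrow> F G X\<close>, then by naturality
  \<open>g \<cdot> \<eta> W = \<eta> (F G X) \<cdot> F G g = F G (\<eta> X \<cdot> g)\<close>, which is the same for \<open>h\<close>; so \<open>\<eta> X\<close> is monic, hence
  invertible. A strict context thus has the inverse \<open>(G, F, \<rho>, \<eta>)\<close>, with \<open>\<eta>\<close> and \<open>\<rho>\<close> themselves as
  the isomorphisms to the identity contexts. Conversely, if \<open>\<Delta>\<close> is inverse to \<open>\<Gamma>\<close>, the composites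
  \<open>\<eta> X \<cdot> F (\<epsilon> (G X))\<close> and \<open>\<rho> Y \<cdot> G (\<delta> (F Y))\<close> are isomorphisms, so \<open>\<eta> X\<close> and \<open>\<rho> Y\<close> are epic.
\<close>

section \<open>Cancellation of epimorphisms and monomorphisms in a category\<close>

lemma HomD: "f \<in> Hom C X Y \<Longrightarrow> f \<in> Arr C \<and> Dom C f = X \<and> Cod C f = Y"
  by (simp add: Hom_def)

lemma (in category) Hom_objects: "f \<in> Hom C X Y \<Longrightarrow> X \<in> Ob C \<and> Y \<in> Ob C"
  using Dom_closed Cod_closed by (auto simp: Hom_def)

lemma is_epiD:
  "is_epi C f \<Longrightarrow> f \<in> Hom C X Y \<Longrightarrow> g \<in> Hom C Y Z \<Longrightarrow> h \<in> Hom C Y Z \<Longrightarrow>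
    g \<cdot>\<^bsub>C\<^esub> f = h \<cdot>\<^bsub>C\<^esub> f \<Longrightarrow> g = h"
  by (auto simp: is_epi_def Hom_def)

lemma is_monoD:
  "is_mono C f \<Longrightarrow> f \<in> Hom C X Y \<Longrightarrow> g \<in> Hom C W X \<Longrightarrow> h \<in> Hom C W X \<Longrightarrow>
    f \<cdot>\<^bsub>C\<^esub> g = f \<cdot>\<^bsub>C\<^esub> h \<Longrightarrow> g = h"
  by (auto simp: is_mono_def Hom_def)

context category
begin

lemma is_epiI:
  assumes "f \<in> Hom C X Y"
    and "\<And>Z g h. g \<in> Hom C Y Z \<Longrightarrow> h \<in> Hom C Y Z \<Longrightarrow> g \<cdot> f = h \<cdot> f \<Longrightarrow> g = h"
  shows "is_epi C f"
  using assms by (auto simp: is_epi_def Hom_def)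

lemma epi_if_comp_epi:
  assumes "q \<in> Hom C W X" and "p \<in> Hom C X Y" and "is_epi C (p \<cdot> q)"
  shows "is_epi C p"
proof (rule is_epiI[OF assms(2)])
  fix Z g h
  assume "g \<in> Hom C Y Z" "h \<in> Hom C Y Z" "g \<cdot> p = h \<cdot> p"
  then show "g = h"
    using is_epiD[OF assms(3) Comp_closed[OF assms(1,2)]]
      Comp_assoc[OF assms(1,2)] by metis
qed

lemma epi_comp:
  assumes "q \<in> Hom C W X" and "p \<in> Hom C X Y" and "is_epi C q" and "is_epi C p"
  shows "is_epi C (p \<cdot> q)"
proof (rule is_epiI[OF Comp_closed[OF assms(1,2)]])
  fix Z g h
  assume g: "g \<in> Hom C Y Z" and h: "h \<in> Hom C Y Z" and eq: "g \<cdot> (p \<cdot> q) = h \<cdot> (p \<cdot> q)"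
  have "(g \<cdot> p) \<cdot> q = (h \<cdot> p) \<cdot> q"
    using eq Comp_assoc[OF assms(1,2)] g h by metis
  then have "g \<cdot> p = h \<cdot> p"
    using is_epiD[OF assms(3,1)] Comp_closed[OF assms(2)] g h by metis
  then show "g = h"
    using is_epiD[OF assms(4,2)] g h by metis
qed

lemma iso_epi:
  assumes "is_iso C f"
  shows "is_epi C f"
proof -
  from assms obtain k where f: "f \<in> Hom C (Dom C f) (Cod C f)"
    and k: "k \<in> Hom C (Cod C f) (Dom C f)" and fk: "f \<cdot> k = Idt C (Cod C f)"
    by (auto simp: is_iso_def Hom_def)
  show ?thesis
  proof (rule is_epiI[OF f])
    fix Z g h
    assume "g \<in> Hom C (Cod C f) Z" "h \<in> Hom C (Cod C f) Z" "g \<cdot> f = h \<cdot> f"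
    then show "g = h"
      using Comp_assoc[OF k f] fk Idt_right by metis
  qed
qed

end

section \<open>Abelian categories are balanced\<close>

lemma (in preadditive_category) Zero_closed:
  "X \<in> Ob C \<Longrightarrow> Y \<in> Ob C \<Longrightarrow> Zero C X Y \<in> Hom C X Y"
  using monoid.one_closed[OF comm_group.axioms(2)[OF hom_comm_group, THEN group.is_monoid]]
  by (simp add: hom_group_def)

text \<open>Bilinearity makes the composite \<open>?z\<close> satisfy \<open>?z\<close> +
  \<open>?z\<close> = \<open>?z\<close>, and cancellation in the group of arrows from
  \<open>X\<close> to \<open>Z\<close> leaves only the zero arrow.\<close>

lemma (in preadditive_category) Comp_Zero_right:
  assumes f: "f \<in> Hom C Y Z" and X: "X \<in> Ob C"
  shows "f \<cdot> Zero C X Y = Zero C X Z"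
proof -
  have Y: "Y \<in> Ob C" and Z: "Z \<in> Ob C"
    using Hom_objects f by auto
  interpret XY: comm_group "hom_group C X Y" by (rule hom_comm_group[OF X Y])
  interpret XZ: comm_group "hom_group C X Z" by (rule hom_comm_group[OF X Z])
  let ?z = "f \<cdot> Zero C X Y"
  have z: "?z \<in> Hom C X Z"
    using Comp_closed[OF Zero_closed[OF X Y] f] .
  have "Add C ?z ?z = f \<cdot> Add C (Zero C X Y) (Zero C X Y)"
    using Comp_Add_right[OF Zero_closed[OF X Y] Zero_closed[OF X Y] f] by simp
  also have "Add C (Zero C X Y) (Zero C X Y) = Zero C X Y"
    using XY.l_one[of "Zero C X Y"] Zero_closed[OF X Y] by (simp add: hom_group_def)
  finally show ?thesis
    using XZ.l_cancel_one[of ?z ?z] z by (simp add: hom_group_def)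
qed

text \<open>Normality presents \<open>c\<close> as the cokernel of some \<open>f\<close>. As
  \<open>c\<close> is monic, \<open>f\<close> must be zero, so the cokernel property gives a left
  inverse of \<open>c\<close>; epicness makes that inverse two-sided.\<close>

lemma (in abelian_category) mono_epi_iso:
  assumes mono: "is_mono C c" and epi: "is_epi C c"
  shows "is_iso C c"
proof -
  define X Y where "X = Dom C c" and "Y = Cod C c"
  have c: "c \<in> Hom C X Y"
    using epi by (simp add: X_def Y_def is_epi_def Hom_def)
  have X: "X \<in> Ob C" and Y: "Y \<in> Ob C"
    using Hom_objects c by auto
  obtain f where coker: "is_cokernel C f c"
    using epi_normal epi by blast
  define W where "W = Dom C f"
  have f: "f \<in> Hom C W X" and cf: "c \<cdot> f = Zero C W Y"
    using coker by (auto simp: is_cokernel_def Hom_def X_def Y_def W_def)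
  have W: "W \<in> Ob C"
    using Hom_objects f by auto
  have "c \<cdot> f = c \<cdot> Zero C W X"
    using cf Comp_Zero_right[OF c W] by simp
  then have "f = Zero C W X"
    using is_monoD[OF mono c] f Zero_closed[OF W X] by blast
  \<comment> \<open>Since the identity of \<open>X\<close> kills \<open>f\<close>, it factors
    through the cokernel \<open>c\<close>; the factor \<open>u\<close> is the left inverse.\<close>
  then have "Idt C X \<cdot> f = Zero C W X"
    using Idt_left[OF f] by simp
  then obtain u where u: "u \<in> Hom C Y X" and uc: "u \<cdot> c = Idt C X"
    using coker Idt_closed[OF X] HomD[OF f] unfolding is_cokernel_def Y_def by metis
  have "(c \<cdot> u) \<cdot> c = Idt C Y \<cdot> c"
    using Comp_assoc[OF c u c] uc Idt_right[OF c] Idt_left[OF c] by simp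
  then have "c \<cdot> u = Idt C Y"
    using is_epiD[OF epi c] Comp_closed[OF u c] Idt_closed[OF Y] by blast
  then show ?thesis
    using c u uc unfolding is_iso_def by (auto dest: HomD)
qed

text \<open>Statements about \<open>\<rho>\<close> reduce along this exchange to those about \<open>\<eta>\<close>.\<close>

definition context_flip ::
  "('a, 'm, 'b, 'n) context_data \<Rightarrow> ('b, 'n, 'a, 'm) context_data" where
  "context_flip \<Gamma> =
    \<lparr>ctxF = ctxG \<Gamma>, ctxG = ctxF \<Gamma>, ctx_eta = ctx_rho \<Gamma>, ctx_rho = ctx_eta \<Gamma>\<rparr>"

lemma context_flip_simps [simp]:
  "ctxF (context_flip \<Gamma>) = ctxG \<Gamma>" "ctxG (context_flip \<Gamma>) = ctxF \<Gamma>"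
  "ctx_eta (context_flip \<Gamma>) = ctx_rho \<Gamma>" "ctx_rho (context_flip \<Gamma>) = ctx_eta \<Gamma>"
  by (simp_all add: context_flip_def)

lemma context_flip_flip [simp]: "context_flip (context_flip \<Gamma>) = \<Gamma>"
  by (simp add: context_flip_def)

lemma fctr_id_simps [simp]: "fob fctr_id X = X" "far fctr_id f = f"
  by (simp_all add: fctr_id_def)

lemma fctr_comp_simps [simp]:
  "fob (G \<circ>\<^sub>F F) X = fob G (fob F X)" "far (G \<circ>\<^sub>F F) f = far G (far F f)"
  by (simp_all add: fctr_comp_def)

lemma right_wide_Morita_context_flip:
  "right_wide_Morita_context A B \<Gamma> \<Longrightarrow> right_wide_Morita_context B A (context_flip \<Gamma>)"
  by (simp add: right_wide_Morita_context_def)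

lemma strict_context_flip:
  "strict_right_wide_Morita_context A B \<Gamma> \<Longrightarrow>
    strict_right_wide_Morita_context B A (context_flip \<Gamma>)"
  by (simp add: strict_right_wide_Morita_context_def right_wide_Morita_context_flip)

section \<open>Projections from contexts, functors and natural transformations\<close>

lemma right_wide_Morita_contextD:
  assumes "right_wide_Morita_context A B \<Gamma>"
  shows "abelian_category A" "abelian_category B"
    and "category A" "category B"
    and "is_fctr B A (ctxF \<Gamma>)" "is_fctr A B (ctxG \<Gamma>)"
    and "is_nat_trans A A (ctxF \<Gamma> \<circ>\<^sub>F ctxG \<Gamma>) fctr_id (ctx_eta \<Gamma>)"
    and "\<And>X. X \<in> Ob A \<Longrightarrow> far (ctxG \<Gamma>) (ctx_eta \<Gamma> X) = ctx_rho \<Gamma> (fob (ctxG \<Gamma>) X)"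
    and "\<And>Y. Y \<in> Ob B \<Longrightarrow> far (ctxF \<Gamma>) (ctx_rho \<Gamma> Y) = ctx_eta \<Gamma> (fob (ctxF \<Gamma>) Y)"
  using assms
  by (auto simp: right_wide_Morita_context_def is_right_exact_fctr_def is_additive_fctr_def
      is_fctr_def)

lemma is_fctrD:
  assumes "is_fctr C D F"
  shows "X \<in> Ob C \<Longrightarrow> fob F X \<in> Ob D"
    and "f \<in> Hom C X Y \<Longrightarrow> far F f \<in> Hom D (fob F X) (fob F Y)"
    and "f \<in> Hom C X Y \<Longrightarrow> g \<in> Hom C Y Z \<Longrightarrow> far F (g \<cdot>\<^bsub>C\<^esub> f) = far F g \<cdot>\<^bsub>D\<^esub> far F f"
  using assms by (auto simp: is_fctr_def)

lemma is_nat_transD: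
  assumes "is_nat_trans C D F G t"
  shows "is_fctr C D F"
    and "X \<in> Ob C \<Longrightarrow> t X \<in> Hom D (fob F X) (fob G X)"
    and "f \<in> Hom C X Y \<Longrightarrow> t Y \<cdot>\<^bsub>D\<^esub> far F f = far G f \<cdot>\<^bsub>D\<^esub> t X"
  using assms by (auto simp: is_nat_trans_def)

section \<open>Strict contexts are equivalences\<close>

lemma strict_context_eta_iso:
  assumes strict: "strict_right_wide_Morita_context A B \<Gamma>" and X: "X \<in> Ob A"
  shows "is_iso A (ctx_eta \<Gamma> X)"
proof -
  let ?\<eta> = "ctx_eta \<Gamma>" and ?T = "ctxF \<Gamma> \<circ>\<^sub>F ctxG \<Gamma>"
  have \<Gamma>: "right_wide_Morita_context A B \<Gamma>" and epi: "\<And>X. X \<in> Ob A \<Longrightarrow> is_epi A (?\<eta> X)"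
    using strict by (auto simp: strict_right_wide_Morita_context_def)
  note D = right_wide_Morita_contextD[OF \<Gamma>]
  interpret A: abelian_category A by (rule D(1))
  note nat = is_nat_transD[OF D(7)]
  note T = is_fctrD[OF nat(1)]
  have \<eta>: "?\<eta> Y \<in> Hom A (fob ?T Y) Y" if "Y \<in> Ob A" for Y
    using nat(2)[OF that] by simp
  \<comment> \<open>First G \<eta> = \<rho> G at \<open>X\<close>, then F \<rho> = \<eta> F at the
    object G X.\<close>
  have T\<eta>: "far ?T (?\<eta> X) = ?\<eta> (fob ?T X)"
    using D(8)[OF X] D(9)[OF is_fctrD(1)[OF D(6) X]] by simp
  have "is_mono A (?\<eta> X)"
    unfolding is_mono_def
  proof (intro conjI allI ballI impI)
    show "?\<eta> X \<in> Arr A"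
      using HomD[OF \<eta>[OF X]] by simp
    fix W g h
    assume "g \<in> Hom A W (Dom A (?\<eta> X))" "h \<in> Hom A W (Dom A (?\<eta> X))"
      and eq: "?\<eta> X \<cdot>\<^bsub>A\<^esub> g = ?\<eta> X \<cdot>\<^bsub>A\<^esub> h"
    then have g: "g \<in> Hom A W (fob ?T X)" and h: "h \<in> Hom A W (fob ?T X)"
      using HomD[OF \<eta>[OF X]] by simp_all
    have W: "W \<in> Ob A"
      using A.Hom_objects[OF g] by simp
    \<comment> \<open>The right-hand side depends on \<open>k\<close> only through its composite
      with \<eta> at \<open>X\<close>, so it takes the same value at \<open>g\<close> and
      \<open>h\<close>.\<close>
    have comp: "k \<cdot>\<^bsub>A\<^esub> ?\<eta> W = far ?T (?\<eta> X \<cdot>\<^bsub>A\<^esub> k)" if k: "k \<in> Hom A W (fob ?T X)" for k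
    proof -
      have "k \<cdot>\<^bsub>A\<^esub> ?\<eta> W = ?\<eta> (fob ?T X) \<cdot>\<^bsub>A\<^esub> far ?T k"
        using nat(3)[OF k] by simp
      then show ?thesis
        using T(3)[OF k \<eta>[OF X]] T\<eta> by simp
    qed
    show "g = h"
      using is_epiD[OF epi[OF W] \<eta>[OF W] g h] comp[OF g] comp[OF h] eq by simp
  qed
  then show ?thesis
    using A.mono_epi_iso epi[OF X] by blast
qed

lemma strict_context_eta_equiv:
  assumes "strict_right_wide_Morita_context A B \<Gamma>"
  shows "is_nat_equiv A A (ctxF \<Gamma> \<circ>\<^sub>F ctxG \<Gamma>) fctr_id (ctx_eta \<Gamma>)"
  using strict_context_eta_iso[OF assms] assms
  by (simp add: is_nat_equiv_def strict_right_wide_Morita_context_def right_wide_Morita_context_def)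

lemma strict_context_iff_equivalence:
  assumes "right_wide_Morita_context A B \<Gamma>"
  shows "strict_right_wide_Morita_context A B \<Gamma> \<longleftrightarrow>
    is_equivalence_of_categories A B (ctxF \<Gamma>) (ctxG \<Gamma>) (ctx_eta \<Gamma>) (ctx_rho \<Gamma>)"
proof
  assume strict: "strict_right_wide_Morita_context A B \<Gamma>"
  show "is_equivalence_of_categories A B (ctxF \<Gamma>) (ctxG \<Gamma>) (ctx_eta \<Gamma>) (ctx_rho \<Gamma>)"
    \<comment> \<open>The flipped context supplies the half about \<rho>, which is its
      \<eta>.\<close>
    using strict_context_eta_equiv[OF strict] strict_context_eta_equiv[OF strict_context_flip[OF strict]]
      right_wide_Morita_contextD(5,6)[OF assms]
    by (simp add: is_equivalence_of_categories_def)
next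
  assume "is_equivalence_of_categories A B (ctxF \<Gamma>) (ctxG \<Gamma>) (ctx_eta \<Gamma>) (ctx_rho \<Gamma>)"
  then show "strict_right_wide_Morita_context A B \<Gamma>"
    using assms category.iso_epi[OF right_wide_Morita_contextD(3)[OF assms]]
      category.iso_epi[OF right_wide_Morita_contextD(4)[OF assms]]
    by (simp add: strict_right_wide_Morita_context_def is_equivalence_of_categories_def
        is_nat_equiv_def)
qed

section \<open>From strict to invertible\<close>

lemma strict_context_comp_flip:
  assumes strict: "strict_right_wide_Morita_context A B \<Gamma>"
  shows "context_isomorphic A A (context_comp A A \<Gamma> (context_flip \<Gamma>)) (context_id A)"
proof -
  let ?\<eta> = "ctx_eta \<Gamma>" and ?T = "ctxF \<Gamma> \<circ>\<^sub>F ctxG \<Gamma>"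
  have \<Gamma>: "right_wide_Morita_context A B \<Gamma>"
    using strict by (simp add: strict_right_wide_Morita_context_def)
  note D = right_wide_Morita_contextD[OF \<Gamma>]
  interpret A: category A by (rule D(3))
  note equiv = strict_context_eta_equiv[OF strict]
  have "Idt A X \<cdot>\<^bsub>A\<^esub> ?\<eta> X \<cdot>\<^bsub>A\<^esub> ?\<eta> (fob ?T X) =
      ?\<eta> X \<cdot>\<^bsub>A\<^esub> far (ctxF \<Gamma>) (ctx_rho \<Gamma> (fob (ctxG \<Gamma>) X))" if X: "X \<in> Ob A" for X
  proof -
    note nat = is_nat_transD[OF D(7)]
    \<comment> \<open>Typing the composite lets \<open>Idt_left\<close> remove the identity; the
      rest is F \<rho> = \<eta> F at G X.\<close>
    have "?\<eta> X \<cdot>\<^bsub>A\<^esub> ?\<eta> (fob ?T X) \<in> Hom A (fob ?T (fob ?T X)) X"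
      using A.Comp_closed[OF nat(2)[OF is_fctrD(1)[OF nat(1) X]]] nat(2)[OF X] by simp
    then show ?thesis
      using A.Idt_left D(9)[OF is_fctrD(1)[OF D(6) X]] by simp
  qed
  then show ?thesis
    unfolding context_isomorphic_def
    \<comment> \<open>One witness serves for both \<open>u\<close> and \<open>v\<close>: the
      composite has F G as both of its functors and the same formula for both of its
      transformations, so the two coherence equations coincide.\<close>
    by (intro exI[of _ ?\<eta>]) (simp add: context_comp_def context_id_def equiv)
qed

text \<open>The inverse is the flipped context. Flipping being an involution, the second composite
  is the first one formed for the flipped context.\<close>

lemma strict_context_invertible:
  assumes strict: "strict_right_wide_Morita_context A B \<Gamma>"
  shows "invertible_context A B \<Gamma>"
  using strict right_wide_Morita_context_flip[of A B \<Gamma>] strict_context_comp_flip[OF strict]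
    strict_context_comp_flip[OF strict_context_flip[OF strict]]
  unfolding invertible_context_def strict_right_wide_Morita_context_def
  by auto

section \<open>From invertible to strict\<close>

lemma eta_epi_if_right_inverse:
  assumes \<Gamma>: "right_wide_Morita_context A B \<Gamma>" and \<Delta>: "right_wide_Morita_context B A \<Delta>"
    and iso: "context_isomorphic A A (context_comp A A \<Gamma> \<Delta>) (context_id A)"
    and X: "X \<in> Ob A"
  shows "is_epi A (ctx_eta \<Gamma> X)"
proof -
  note D = right_wide_Morita_contextD[OF \<Gamma>] and E = right_wide_Morita_contextD[OF \<Delta>]
  interpret A: category A by (rule D(3))
  let ?F = "ctxF \<Gamma>" and ?G = "ctxG \<Gamma>" and ?U = "ctxF \<Delta>" and ?V = "ctxG \<Delta>"
  let ?q = "far ?F (ctx_eta \<Delta> (fob ?G X))"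
  obtain u v where u: "is_nat_equiv A A (?F \<circ>\<^sub>F ?U) fctr_id u"
    and v: "is_nat_equiv A A (?V \<circ>\<^sub>F ?G) fctr_id v"
    \<comment> \<open>This is the coherence equation for \<eta>, with the identity context as
      target: its functors disappear and its \<eta> is \<open>Idt A\<close>. The left side is a
      composite of isomorphisms.\<close>
    and eq: "Idt A X \<cdot>\<^bsub>A\<^esub> v X \<cdot>\<^bsub>A\<^esub> u (fob ?V (fob ?G X)) = ctx_eta \<Gamma> X \<cdot>\<^bsub>A\<^esub> ?q"
    using iso X by (auto simp: context_isomorphic_def context_comp_def context_id_def)
  have GX: "fob ?G X \<in> Ob B"
    by (rule is_fctrD(1)[OF D(6) X])
  have VGX: "fob ?V (fob ?G X) \<in> Ob A"
    by (rule is_fctrD(1)[OF E(6) GX])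
  have vX: "v X \<in> Hom A (fob ?V (fob ?G X)) X" "is_epi A (v X)"
    using v X A.iso_epi by (auto simp: is_nat_equiv_def is_nat_trans_def)
  have uX: "u (fob ?V (fob ?G X)) \<in> Hom A (fob ?F (fob ?U (fob ?V (fob ?G X)))) (fob ?V (fob ?G X))"
    "is_epi A (u (fob ?V (fob ?G X)))"
    using u VGX A.iso_epi by (auto simp: is_nat_equiv_def is_nat_trans_def)
  have q: "?q \<in> Hom A (fob ?F (fob ?U (fob ?V (fob ?G X)))) (fob ?F (fob ?G X))"
    using is_fctrD(2)[OF D(5) is_nat_transD(2)[OF E(7) GX]] by simp
  have \<eta>: "ctx_eta \<Gamma> X \<in> Hom A (fob ?F (fob ?G X)) X"
    using is_nat_transD(2)[OF D(7) X] by simp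
  have "is_epi A (ctx_eta \<Gamma> X \<cdot>\<^bsub>A\<^esub> ?q)"
    using A.epi_comp[OF uX(1) vX(1) uX(2) vX(2)] A.Idt_left[OF A.Comp_closed[OF uX(1) vX(1)]] eq
    by simp
  then show ?thesis
    by (rule A.epi_if_comp_epi[OF q \<eta>])
qed

text \<open>The witnesses \<open>u\<close> and \<open>v\<close> trade places, and so do the two
  coherence equations.\<close>

lemma context_isomorphic_flip:
  assumes "context_isomorphic A B \<Gamma> \<Gamma>'"
  shows "context_isomorphic B A (context_flip \<Gamma>) (context_flip \<Gamma>')"
  using assms unfolding context_isomorphic_def by auto

text \<open>The formulas for \<eta> and \<rho> of a composite mirror each other, so flipping
  reverses the order of composition and turns left inverses into right inverses.\<close>

lemma context_flip_comp:
  "context_flip (context_comp A C \<Gamma> \<Delta>) = context_comp C A (context_flip \<Delta>) (context_flip \<Gamma>)"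
  by (simp add: context_flip_def context_comp_def)

lemma context_flip_id: "context_flip (context_id A) = context_id A"
  by (simp add: context_flip_def context_id_def)

lemma invertible_context_strict:
  assumes "invertible_context A B \<Gamma>"
  shows "strict_right_wide_Morita_context A B \<Gamma>"
proof -
  obtain \<Delta> where \<Gamma>: "right_wide_Morita_context A B \<Gamma>" and \<Delta>: "right_wide_Morita_context B A \<Delta>"
    and right: "context_isomorphic A A (context_comp A A \<Gamma> \<Delta>) (context_id A)"
    and left: "context_isomorphic B B (context_comp B B \<Delta> \<Gamma>) (context_id B)"
    using assms by (auto simp: invertible_context_def)
  \<comment> \<open>Flipping \<open>\<Delta>\<close> gives a right inverse of the flipped
    \<open>\<Gamma>\<close>, whose \<eta> is the \<rho> of \<open>\<Gamma>\<close>.\<close>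
  have "context_isomorphic B B (context_comp B B (context_flip \<Gamma>) (context_flip \<Delta>)) (context_id B)"
    using context_isomorphic_flip[OF left] by (simp add: context_flip_comp context_flip_id)
  then have "is_epi B (ctx_rho \<Gamma> Y)" if "Y \<in> Ob B" for Y
    using eta_epi_if_right_inverse[OF right_wide_Morita_context_flip[OF \<Gamma>]
        right_wide_Morita_context_flip[OF \<Delta>] _ that] by simp
  then show ?thesis
    using \<Gamma> eta_epi_if_right_inverse[OF \<Gamma> \<Delta> right]
    by (simp add: strict_right_wide_Morita_context_def)
qed

text \<open>Strictness is defined by epimorphisms alone; the second conjunct expresses the
  reformulation of assertion (2) as an equivalence of categories.\<close>

theorem proposition2p10:
  fixes A :: "('a, 'm) ab_cat"
    and B :: "('b, 'n) ab_cat"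
    and \<Gamma> :: "('a, 'm, 'b, 'n) context_data"
  assumes "abelian_category A" and "abelian_category B"
    and "right_wide_Morita_context A B \<Gamma>"
  shows "(invertible_context A B \<Gamma> \<longleftrightarrow> strict_right_wide_Morita_context A B \<Gamma>) \<and>
    (strict_right_wide_Morita_context A B \<Gamma> \<longleftrightarrow>
      is_equivalence_of_categories A B (ctxF \<Gamma>) (ctxG \<Gamma>) (ctx_eta \<Gamma>) (ctx_rho \<Gamma>))"
  using invertible_context_strict strict_context_invertible
    strict_context_iff_equivalence[OF assms(3)] by blast

end
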